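(* Let $\mathcal{M}=(\mathcal{F},r_0,r_1,r_2)$ be a finite dart-transitive map of valence $q$ with at least two vertices. Then for every consistent closed flag-walk in $\mathcal{M}$, its edge-set is either a cycle, (the edge-set of) a twining, a bead, or a bracelet.
   Context: Permutations act on the right and products are composed left to right: $\Phi^{r_0r_1}=(\Phi^{r_0})^{r_1}$. A map is a tuple $\mathcal{M}=(\mathcal{F},r_0,r_1,r_2)$ where $\mathcal{F}$ is a non-empty set (of flags) and $r_0,r_1,r_2$ are fixed-point-free permutations of $\mathcal{F}$ with $r_0^2=r_1^2=r_2^2=(r_0r_2)^2=1$, such that $\langle r_0,r_1,r_2\rangle$ is transitive on $\mathcal{F}$ and for every flag $\Phi$ the flags $\Phi^{r_0},\Phi^{r_1},\Phi^{r_2}$ are pairwise distinct. It is finite if $\mathcal{F}$ is finite. Write $\Phi^i=\Phi^{r_i}$. Vertices are the orbits of $\langle r_1,r_2\rangle$, edges the orbits of $\langle r_0,r_2\rangle$, darts the orbits of $\langle r_2\rangle$; incidence is non-empty intersection, and the endvertices of an edge are the vertices incident with it. The valence of a vertex is the number of darts it contains (half its number of flags); $\mathcal{M}$ has valence $q$ if all its vertices have valence $q$. The skeleton of $\mathcal{M}$ is the resulting graph (possibly with parallel edges and loops) on the vertices and edges of $\mathcal{M}$. An automorphism (symmetry) of $\mathcal{M}$ is a permutation of $\mathcal{F}$ commuting with $r_0,r_1,r_2$; $\mathrm{Aut}(\mathcal{M})$ is the group of all of them, and $\mathcal{M}$ is dart-transitive if $\mathrm{Aut}(\mathcal{M})$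 is transitive on darts. A closed flag-walk of length $n\ge 1$ is a sequence $(\Phi_0,\dots,\Phi_{n-1})$ of flags such that, for all $i$ (indices modulo $n$), $\Phi_i^0$ and $\Phi_{i+1}$ belong to the same vertex but not to the same dart (no backtracking). It is consistent if there is $g\in\mathrm{Aut}(\mathcal{M})$ of order $n$ with $\Phi_i^g=\Phi_{i+1}$ for $i=0,\dots,n-2$. Its edge-set is the set of edges of $\mathcal{M}$ containing at least one of the flags $\Phi_i$. Subtending: let $\Phi$ be a flag in the edge $e$ and the vertex $v$, and let $d$ be less than the valence of $v$. The flags $\Phi^{(r_1r_2)^d}$ and $\Phi^{(r_1r_2)^{d-1}r_1}$ belong to a common edge $e'$ incident with $v$; then $e$ and $e'$ are said to subtend $d$ faces at $v$ (they then also subtend $q-d$ faces at $v$, if $v$ has valence $q$). The four configurations are as follows. - A cycle is the edge-set of a closed walk (in the skeleton) having no repetitions of vertices or edges; it may have as few as two edges. - A twining is a closed walk of length $2k$ with edges $[e_0,e_1,\dots,e_{2k-1}]$ such that: (i) it passes through $k$ distinct vertices $v_0,\dots,v_{k-1}$; (ii) for all $0\le i\le k-1$, $e_i$ and $e_{i+k}$ have the same endvertices, namely $v_i$ and $v_{i+1}$ (indices of vertices modulo $k$); (iii) there are numbers $d,d'$ such that for all $i$, at $v_i$ the edges $e_i$ and $e_{i+k}$ subtend $d$ faces, while at $v_{i+1}$ the edges $e_i$ and $e_{i+k}$ subtend $d'$ faces; (iv) there is a symmetry $\mu\in\mathrm{Aut}(\mathcal{M})$ fixing each $v_i$ and interchanging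 each $e_i$ with $e_{i+k}$. - A $d$-bead is a set of edges having the same two endvertices, say $u$ and $v$, such that at $u$, and also at $v$, each pair of consecutive edges of the set (consecutive in the cyclic order of the edges around that vertex) subtend $d$ faces. A bead is a $d$-bead for some $d$. - A bracelet is a union of $d$-beads, for some fixed $d$, which has the same vertices as some cycle (the beads joining the consecutive vertices of the cycle). The underlying cycle may have only two vertices, in which case the bracelet is the union of two beads, each on the same two vertices. *)

theory Defs
  imports "HOL-Algebra.Generated_Groups" "HOL-Algebra.Multiplicative_Group"
    "HOL-Combinatorics.Permutations"
begin

text \<open>
  Permutations act on the right, so the product \<open>p \<otimes> q\<close> is ``first \<open>p\<close>, then \<open>q\<close>'', and the
  flag obtained from \<open>x\<close> by applying the product \<open>r1 r2\<close> is \<open>(r2 \<circ> r1) x\<close>.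
\<close>

definition perm_group :: "'f set \<Rightarrow> ('f \<Rightarrow> 'f) monoid" where
  "perm_group F = \<lparr>carrier = {p. p permutes F}, monoid.mult = (\<lambda>p q. q \<circ> p), one = id\<rparr>"

lemma group_perm_group: "group (perm_group F)"
proof (rule groupI)
  fix p assume "p \<in> carrier (perm_group F)"
  then have "p permutes F" by (simp add: perm_group_def)
  then show "\<exists>q\<in>carrier (perm_group F). q \<otimes>\<^bsub>perm_group F\<^esub> p = \<one>\<^bsub>perm_group F\<^esub>"
    using permutes_inv[of p F] permutes_inv_o(1)[of p F]
    by (auto simp: perm_group_def)
qed (auto simp: perm_group_def permutes_compose permutes_id o_assoc)

definition gen_orbit :: "'f set \<Rightarrow> ('f \<Rightarrow> 'f) set \<Rightarrow> 'f \<Rightarrow> 'f set" where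
  "gen_orbit F S x = {p x | p. p \<in> generate (perm_group F) S}"

record 'f flag_map =
  flags :: "'f set"
  r0 :: "'f \<Rightarrow> 'f"
  r1 :: "'f \<Rightarrow> 'f"
  r2 :: "'f \<Rightarrow> 'f"

definition is_map :: "'f flag_map \<Rightarrow> bool" where
  "is_map M \<longleftrightarrow>
     flags M \<noteq> {} \<and>
     (\<forall>r\<in>{r0 M, r1 M, r2 M}. r permutes flags M \<and> (\<forall>x\<in>flags M. r x \<noteq> x) \<and> r ^^ 2 = id) \<and>
     (r2 M \<circ> r0 M) ^^ 2 = id \<and>
     (\<forall>x\<in>flags M. \<forall>y\<in>flags M. y \<in> gen_orbit (flags M) {r0 M, r1 M, r2 M} x) \<and>
     (\<forall>x\<in>flags M. r0 M x \<noteq> r1 M x \<and> r0 M x \<noteq> r2 M x \<and> r1 M x \<noteq> r2 M x)"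

definition vertices :: "'f flag_map \<Rightarrow> 'f set set" where
  "vertices M = gen_orbit (flags M) {r1 M, r2 M} ` flags M"

definition edges :: "'f flag_map \<Rightarrow> 'f set set" where
  "edges M = gen_orbit (flags M) {r0 M, r2 M} ` flags M"

definition darts :: "'f flag_map \<Rightarrow> 'f set set" where
  "darts M = gen_orbit (flags M) {r2 M} ` flags M"

definition endvertices :: "'f flag_map \<Rightarrow> 'f set \<Rightarrow> 'f set set" where
  "endvertices M e = {v \<in> vertices M. v \<inter> e \<noteq> {}}"

definition valence :: "'f flag_map \<Rightarrow> 'f set \<Rightarrow> nat" where
  "valence M v = card {D \<in> darts M. D \<subseteq> v}"

definition has_valence :: "'f flag_map \<Rightarrow> nat \<Rightarrow> bool" where
  "has_valence M q \<longleftrightarrow> (\<forall>v\<in>vertices M. valence M v = q)"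

definition Aut :: "'f flag_map \<Rightarrow> ('f \<Rightarrow> 'f) monoid" where
  "Aut M = (perm_group (flags M))
     \<lparr>carrier := {g. g permutes flags M \<and> (\<forall>r\<in>{r0 M, r1 M, r2 M}. g \<circ> r = r \<circ> g)}\<rparr>"

lemma group_Aut: "group (Aut M)"
proof (rule groupI)
  fix g assume "g \<in> carrier (Aut M)"
  then have g: "g permutes flags M" and c: "\<forall>r\<in>{r0 M, r1 M, r2 M}. g \<circ> r = r \<circ> g"
    by (simp_all add: Aut_def)
  have "inv_into UNIV g \<circ> r = r \<circ> inv_into UNIV g" if "g \<circ> r = r \<circ> g" for r
  proof
    fix x
    have "g (r (inv_into UNIV g x)) = r x"
      using fun_cong[OF that, of "inv_into UNIV g x"] permutes_inverses(1)[OF g] by simp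
    then show "(inv_into UNIV g \<circ> r) x = (r \<circ> inv_into UNIV g) x"
      using permutes_inverses(2)[OF g] by (metis comp_apply)
  qed
  with g c have "inv_into UNIV g \<in> carrier (Aut M)"
    using permutes_inv[OF g] by (simp add: Aut_def)
  moreover have "inv_into UNIV g \<otimes>\<^bsub>Aut M\<^esub> g = \<one>\<^bsub>Aut M\<^esub>"
    using permutes_inv_o(1)[OF g] by (simp add: Aut_def perm_group_def)
  ultimately show "\<exists>h\<in>carrier (Aut M). h \<otimes>\<^bsub>Aut M\<^esub> g = \<one>\<^bsub>Aut M\<^esub>" by blast
qed (auto simp: Aut_def perm_group_def permutes_compose permutes_id fun_eq_iff)

definition dart_transitive :: "'f flag_map \<Rightarrow> bool" where
  "dart_transitive M \<longleftrightarrow> (\<forall>D\<in>darts M. \<forall>D'\<in>darts M. \<exists>g\<in>carrier (Aut M). g ` D = D')"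

definition closed_flag_walk :: "'f flag_map \<Rightarrow> 'f list \<Rightarrow> bool" where
  "closed_flag_walk M W \<longleftrightarrow>
     1 \<le> length W \<and> set W \<subseteq> flags M \<and>
     (\<forall>i<length W. let x = r0 M (W ! i); y = W ! (Suc i mod length W) in
        (\<exists>v\<in>vertices M. x \<in> v \<and> y \<in> v) \<and> \<not> (\<exists>D\<in>darts M. x \<in> D \<and> y \<in> D))"

definition consistent :: "'f flag_map \<Rightarrow> 'f list \<Rightarrow> bool" where
  "consistent M W \<longleftrightarrow>
     (\<exists>g\<in>carrier (Aut M). group.ord (Aut M) g = length W \<and>
        (\<forall>i. Suc i < length W \<longrightarrow> g (W ! i) = W ! Suc i))"

definition edge_set :: "'f flag_map \<Rightarrow> 'f list \<Rightarrow> 'f set set" where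
  "edge_set M W = {e \<in> edges M. \<exists>x\<in>set W. x \<in> e}"

text \<open>
  Here \<open>1 \<le> d\<close>, so that the exponent \<open>d - 1\<close> is a natural number (\<open>d = 0\<close> would compare a dart
  with itself).  The relation is symmetric in the two edges, and invariant under replacing \<open>d\<close>
  by \<open>valence M v - d\<close>, because \<open>x\<close> may be replaced by \<open>r2 M x\<close>, which reverses the direction of
  rotation around \<open>v\<close>.
\<close>
definition subtend :: "'f flag_map \<Rightarrow> nat \<Rightarrow> 'f set \<Rightarrow> 'f set \<Rightarrow> 'f set \<Rightarrow> bool" where
  "subtend M d v e e' \<longleftrightarrow>
     v \<in> vertices M \<and> e \<in> edges M \<and> e' \<in> edges M \<and> 1 \<le> d \<and> d < valence M v \<and>
     (\<exists>x \<in> e \<inter> v. ((r2 M \<circ> r1 M) ^^ d) x \<in> e' \<and> r1 M (((r2 M \<circ> r1 M) ^^ (d - 1)) x) \<in> e')"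

text \<open>
  A closed walk in the skeleton, given by its vertices \<open>vs\<close> and edges \<open>es\<close>: the edge \<open>es ! i\<close>
  joins \<open>vs ! i\<close> to the cyclically next vertex.
\<close>
definition closed_walk :: "'f flag_map \<Rightarrow> 'f set list \<Rightarrow> 'f set list \<Rightarrow> bool" where
  "closed_walk M vs es \<longleftrightarrow>
     1 \<le> length es \<and> length vs = length es \<and> set vs \<subseteq> vertices M \<and> set es \<subseteq> edges M \<and>
     (\<forall>i<length es. endvertices M (es ! i) = {vs ! i, vs ! (Suc i mod length es)})"

definition cyclic_walk :: "'f flag_map \<Rightarrow> 'f set list \<Rightarrow> 'f set list \<Rightarrow> bool" where
  "cyclic_walk M vs es \<longleftrightarrow> closed_walk M vs es \<and> 2 \<le> length es \<and> distinct vs \<and> distinct es"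

definition is_cycle :: "'f flag_map \<Rightarrow> 'f set set \<Rightarrow> bool" where
  "is_cycle M E \<longleftrightarrow> (\<exists>vs es. cyclic_walk M vs es \<and> E = set es)"

text \<open>
  The twining traverses the vertices \<open>vs\<close> twice; its condition on the endvertices of \<open>es ! i\<close>
  and \<open>es ! (i + k)\<close> is part of \<open>closed_walk M (vs @ vs) es\<close>, but is restated explicitly.
\<close>
definition twining :: "'f flag_map \<Rightarrow> 'f set list \<Rightarrow> 'f set list \<Rightarrow> bool" where
  "twining M vs es \<longleftrightarrow>
     closed_walk M (vs @ vs) es \<and> distinct vs \<and>
     (let k = length vs in
       (\<forall>i<k. endvertices M (es ! i) = {vs ! i, vs ! (Suc i mod k)} \<and>
              endvertices M (es ! (i + k)) = {vs ! i, vs ! (Suc i mod k)}) \<and>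
       (\<exists>d d'. \<forall>i<k. subtend M d (vs ! i) (es ! i) (es ! (i + k)) \<and>
                      subtend M d' (vs ! (Suc i mod k)) (es ! i) (es ! (i + k))) \<and>
       (\<exists>\<mu>\<in>carrier (Aut M). \<forall>i<k. \<mu> ` (vs ! i) = vs ! i \<and>
                      \<mu> ` (es ! i) = es ! (i + k) \<and> \<mu> ` (es ! (i + k)) = es ! i))"

definition is_twining :: "'f flag_map \<Rightarrow> 'f set set \<Rightarrow> bool" where
  "is_twining M E \<longleftrightarrow> (\<exists>vs es. twining M vs es \<and> E = set es)"

text \<open>
  \<open>e'\<close> is the first edge of \<open>B\<close> met after \<open>e\<close> when rotating around the vertex \<open>v\<close>, in the
  direction determined by the starting flag \<open>x\<close>.
\<close>
definition consecutive :: "'f flag_map \<Rightarrow> 'f set \<Rightarrow> 'f set set \<Rightarrow> 'f set \<Rightarrow> 'f set \<Rightarrow> bool" where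
  "consecutive M v B e e' \<longleftrightarrow>
     e \<in> B \<and> e' \<in> B \<and>
     (\<exists>x \<in> e \<inter> v. \<exists>j\<ge>1. ((r2 M \<circ> r1 M) ^^ j) x \<in> e' \<and>
        (\<forall>i. 1 \<le> i \<and> i < j \<longrightarrow> ((r2 M \<circ> r1 M) ^^ i) x \<notin> \<Union>B))"

definition bead_between ::
    "'f flag_map \<Rightarrow> nat \<Rightarrow> 'f set \<Rightarrow> 'f set \<Rightarrow> 'f set set \<Rightarrow> bool" where
  "bead_between M d u v B \<longleftrightarrow>
     u \<noteq> v \<and> B \<subseteq> edges M \<and> (\<exists>e\<in>B. \<exists>e'\<in>B. e \<noteq> e') \<and>
     (\<forall>e\<in>B. endvertices M e = {u, v}) \<and>
     (\<forall>w\<in>{u, v}. \<forall>e e'. consecutive M w B e e' \<longrightarrow> subtend M d w e e')"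

definition is_bead :: "'f flag_map \<Rightarrow> 'f set set \<Rightarrow> bool" where
  "is_bead M E \<longleftrightarrow> (\<exists>d u v. bead_between M d u v E)"

text \<open>
  The requirement that the beads be distinct only matters when the underlying cycle has two
  vertices: a bracelet is then a union of two beads on the same two vertices.
\<close>
definition is_bracelet :: "'f flag_map \<Rightarrow> 'f set set \<Rightarrow> bool" where
  "is_bracelet M E \<longleftrightarrow>
     (\<exists>d vs es Bs. cyclic_walk M vs es \<and> length Bs = length vs \<and> distinct Bs \<and>
        (\<forall>i<length vs. bead_between M d (vs ! i) (vs ! (Suc i mod length vs)) (Bs ! i)) \<and>
        E = \<Union>(set Bs))"

end

theory Submission
  imports Defs "HOL-Combinatorics.Cycles"
begin

text \<open>
  Let \<open>g\<close> be the symmetry of order \<open>n\<close> that shifts the consistent walk, so that the flags of the walk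
  are \<open>y i = (g ^^ i) x\<close>, and let \<open>v i\<close> and \<open>e i\<close> be the vertex and the edge of \<open>y i\<close>; then \<open>e i\<close> joins
  \<open>v i\<close> to \<open>v (i + 1)\<close>.  Let \<open>k \<ge> 1\<close> be least with \<open>v k = v 0\<close>, and put \<open>h = g ^^ k\<close>.  Dart-transitivity and the
  presence of two vertices exclude loops (\<open>no_loops\<close>), so \<open>k \<ge> 2\<close>.  The vertices \<open>v 0, \<dots>, v (k - 1)\<close>
  are distinct, and as the walk does not backtrack so are the edges \<open>e 0, \<dots>, e (k - 1)\<close> (\<open>e_inj\<close>):
  these form a cycle.  The automorphism \<open>h\<close> fixes each \<open>v i\<close>, and there are three cases.

  If \<open>h\<close> fixes \<open>e 0\<close>, then it fixes all \<open>e i\<close>, and the edge-set is that cycle (\<open>cycle_if_edge_fixed\<close>).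

  If \<open>h\<close> moves \<open>e 0\<close> and is an involution, then it interchanges \<open>e i\<close> with \<open>e (i + k)\<close>, and the walk is a
  twining with symmetry \<open>h\<close> (\<open>twining_if_involution\<close>).

  Otherwise \<open>h\<close> acts on each \<open>v i\<close> as a rotation (\<open>rotates\<close>), since a reflection of a vertex is an
  involution on its flags and an automorphism fixing a flag is the identity (\<open>aut_fix\<close>).  The orbit of
  \<open>e i\<close> under \<open>h\<close> is then evenly spread around \<open>v i\<close> and around \<open>v (i + 1)\<close>, with the same number \<open>d\<close> of
  faces between consecutive edges, so it is a bead (\<open>orbit_bead\<close>).  The number \<open>d\<close> is the least
  positive number of rotation steps leading from a flag back into its own orbit under \<open>h\<close>
  (\<open>spacing\<close>).  It is constant along each vertex because \<open>h\<close> commutes with \<open>r1\<close> and \<open>r2\<close>, and along the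
  walk because \<open>h\<close> commutes with \<open>g\<close>.  The \<open>k\<close> beads form a bracelet, unless \<open>k = 2\<close> and both are the
  same bead (\<open>bead_or_bracelet\<close>).
\<close>

section \<open>Orbits of groups generated by involutions\<close>

lemma gen_orbit_self: "x \<in> gen_orbit F S x"
  unfolding gen_orbit_def mem_Collect_eq using generate.one[of "perm_group F" S]
  by (intro exI[of _ id]) (simp add: perm_group_def)

lemma gen_orbit_closed:
  assumes "y \<in> gen_orbit F S x" "s \<in> S"
  shows "s y \<in> gen_orbit F S x"
proof -
  obtain p where p: "p \<in> generate (perm_group F) S" "y = p x"
    using assms(1) by (auto simp: gen_orbit_def)
  then have "s \<circ> p \<in> generate (perm_group F) S"
    using generate.eng[OF p(1) generate.incl[OF assms(2)]] by (simp add: perm_group_def)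
  then show ?thesis
    using p(2) unfolding gen_orbit_def mem_Collect_eq by (intro exI[of _ "s \<circ> p"]) simp
qed

text \<open>Since a generating involution is its own inverse, the orbit of \<open>x\<close> is the least set that
  contains \<open>x\<close> and is closed under the generators; this turns every statement about orbits below
  into a closure check.\<close>
lemma gen_orbit_subset:
  assumes S: "\<And>s. s \<in> S \<Longrightarrow> s permutes F \<and> s \<circ> s = id"
    and "x \<in> A" and A: "\<And>s y. s \<in> S \<Longrightarrow> y \<in> A \<Longrightarrow> s y \<in> A"
  shows "gen_orbit F S x \<subseteq> A"
proof -
  interpret group "perm_group F" by (rule group_perm_group)
  have "p y \<in> A" if "p \<in> generate (perm_group F) S" "y \<in> A" for p y
    using that
  proof (induction p arbitrary: y rule: generate.induct)
    case (inv s)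
    have "inv\<^bsub>perm_group F\<^esub> s = s"
      using S[OF inv(1)] by (intro inv_equality) (auto simp: perm_group_def)
    then show ?case using A inv by simp
  qed (auto simp: perm_group_def A)
  then show ?thesis using \<open>x \<in> A\<close> by (auto simp: gen_orbit_def)
qed

lemma gen_orbit_eq:
  assumes S: "\<And>s. s \<in> S \<Longrightarrow> s permutes F \<and> s \<circ> s = id"
    and y: "y \<in> gen_orbit F S x"
  shows "gen_orbit F S y = gen_orbit F S x"
proof
  show "gen_orbit F S y \<subseteq> gen_orbit F S x"
    using S y gen_orbit_closed by (intro gen_orbit_subset) auto
  have "gen_orbit F S x \<subseteq> {z. x \<in> gen_orbit F S z}"
  proof (rule gen_orbit_subset[OF S])
    fix s z assume s: "s \<in> S" and z: "z \<in> {z. x \<in> gen_orbit F S z}"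
    have "s (s z) = z" using S[OF s] by (metis comp_apply id_apply)
    then have "z \<in> gen_orbit F S (s z)"
      using gen_orbit_closed[OF gen_orbit_self s] by metis
    then have "gen_orbit F S z \<subseteq> gen_orbit F S (s z)"
      using S gen_orbit_closed by (intro gen_orbit_subset) auto
    then show "s z \<in> {z. x \<in> gen_orbit F S z}" using z by auto
  qed (auto simp: gen_orbit_self)
  then have "x \<in> gen_orbit F S y" using y by auto
  then show "gen_orbit F S x \<subseteq> gen_orbit F S y"
    using S gen_orbit_closed by (intro gen_orbit_subset) auto
qed

lemma gen_orbit_image:
  assumes S: "\<And>s. s \<in> S \<Longrightarrow> s permutes F \<and> s \<circ> s = id"
    and f: "\<And>s y. s \<in> S \<Longrightarrow> f (s y) = s (f y)"
  shows "f ` gen_orbit F S x = gen_orbit F S (f x)"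
proof
  have "gen_orbit F S x \<subseteq> {z. f z \<in> gen_orbit F S (f x)}"
    using gen_orbit_closed by (intro gen_orbit_subset[OF S]) (auto simp: gen_orbit_self f)
  then show "f ` gen_orbit F S x \<subseteq> gen_orbit F S (f x)" by auto
  show "gen_orbit F S (f x) \<subseteq> f ` gen_orbit F S x"
  proof (rule gen_orbit_subset[OF S])
    show "f x \<in> f ` gen_orbit F S x" by (rule imageI[OF gen_orbit_self])
    fix s y assume s: "s \<in> S" and "y \<in> f ` gen_orbit F S x"
    then obtain z where z: "z \<in> gen_orbit F S x" "y = f z" by blast
    then show "s y \<in> f ` gen_orbit F S x"
      using imageI[OF gen_orbit_closed[OF z(1) s], of f] f[OF s] by metis
  qed
qed

lemma funpow_comm:
  assumes "\<And>y. f (g y) = g (f y)"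
  shows "(f ^^ i) ((g ^^ j) x) = (g ^^ j) ((f ^^ i) x)"
proof -
  have "f ((g ^^ j) y) = (g ^^ j) (f y)" for y by (induction j) (auto simp: assms)
  then show ?thesis by (induction i) auto
qed

lemma permutes_power_inverse:
  assumes "p permutes F" "finite F"
  obtains i where "\<And>x. (p ^^ i) ((p ^^ j) x) = x"
proof -
  have "permutation p" using assms permutation_permutes by blast
  then obtain n where n: "p ^^ n = id" "n > j" by (rule permutation_is_nilpotent')
  have "(p ^^ (n - j)) ((p ^^ j) x) = x" for x
    using n fun_cong[OF funpow_add[of "n - j" j p], of x] by simp
  then show ?thesis by (rule that)
qed

lemma range_periodic:
  assumes "0 < p" "\<And>i. f (i + p) = f i"
  shows "range f = f ` {0..<p::nat}"
proof -
  have "f (c + p * b) = f c" for b c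
  proof (induction b)
    case (Suc b)
    then show ?case using assms(2)[of "c + p * b"] by (simp add: algebra_simps)
  qed simp
  then have "f i = f (i mod p)" for i by (metis mod_mult_div_eq)
  then have "f i \<in> f ` {0..<p}" for i
    using assms(1) by (metis atLeastLessThan_iff imageI mod_less_divisor zero_le)
  then show ?thesis by blast
qed


section \<open>Vertices, edges and darts of a finite map\<close>

locale finite_map =
  fixes M :: "'f flag_map"
  assumes map: "is_map M" and fin: "finite (flags M)"
begin

abbreviation rot :: "'f \<Rightarrow> 'f" where "rot \<equiv> r2 M \<circ> r1 M"
abbreviation vertex_of :: "'f \<Rightarrow> 'f set" where
  "vertex_of \<equiv> gen_orbit (flags M) {r1 M, r2 M}"
abbreviation edge_of :: "'f \<Rightarrow> 'f set" where
  "edge_of \<equiv> gen_orbit (flags M) {r0 M, r2 M}"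
abbreviation dart_of :: "'f \<Rightarrow> 'f set" where
  "dart_of \<equiv> gen_orbit (flags M) {r2 M}"

lemma gens: "s \<in> {r0 M, r1 M, r2 M} \<Longrightarrow> s permutes flags M \<and> s \<circ> s = id"
  using map by (auto simp: is_map_def numeral_2_eq_2)

lemma r_r [simp]: "r0 M (r0 M x) = x" "r1 M (r1 M x) = x" "r2 M (r2 M x) = x"
  using gens by (metis comp_apply id_apply insertI1 insertI2)+

lemma r2_r0: "r2 M (r0 M x) = r0 M (r2 M x)"
proof -
  have "(r2 M \<circ> r0 M) ^^ 2 = id" using map by (simp add: is_map_def)
  then have "r2 M (r0 M (r2 M (r0 M z))) = z" for z
    by (simp add: numeral_2_eq_2 fun_eq_iff)
  from this[of "r0 M (r2 M x)"] show ?thesis by simp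
qed

lemma r_flags [simp]:
  "r0 M x \<in> flags M \<longleftrightarrow> x \<in> flags M" "r1 M x \<in> flags M \<longleftrightarrow> x \<in> flags M"
  "r2 M x \<in> flags M \<longleftrightarrow> x \<in> flags M"
  using gens by (auto simp: permutes_in_image)

lemma r_neq:
  assumes "x \<in> flags M"
  shows "r1 M x \<noteq> x" "r2 M x \<noteq> x"
  using map assms by (auto simp: is_map_def)

lemmas vertex_of_eq = gen_orbit_eq[of "{r1 M, r2 M}" "flags M", OF gens]
lemmas edge_of_eq = gen_orbit_eq[of "{r0 M, r2 M}" "flags M", OF gens]

lemma vertex_of_r [simp]: "vertex_of (r1 M x) = vertex_of x" "vertex_of (r2 M x) = vertex_of x"
  by (rule vertex_of_eq; auto intro: gen_orbit_closed gen_orbit_self)+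

lemma edge_of_r [simp]: "edge_of (r0 M x) = edge_of x" "edge_of (r2 M x) = edge_of x"
  by (rule edge_of_eq; auto intro: gen_orbit_closed gen_orbit_self)+

lemma edge_of_iff: "y \<in> edge_of x \<longleftrightarrow> y \<in> {x, r2 M x, r0 M x, r2 M (r0 M x)}"
proof
  have "edge_of x \<subseteq> {x, r2 M x, r0 M x, r2 M (r0 M x)}"
    by (rule gen_orbit_subset[OF gens]) (auto simp: r2_r0 simp flip: r2_r0)
  then show "y \<in> edge_of x \<Longrightarrow> y \<in> {x, r2 M x, r0 M x, r2 M (r0 M x)}" by auto
qed (auto intro: gen_orbit_closed gen_orbit_self)

lemma dart_of_iff: "y \<in> dart_of x \<longleftrightarrow> y = x \<or> y = r2 M x"
proof
  have "dart_of x \<subseteq> {x, r2 M x}" by (rule gen_orbit_subset[OF gens]) auto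
  then show "y \<in> dart_of x \<Longrightarrow> y = x \<or> y = r2 M x" by auto
qed (auto intro: gen_orbit_closed gen_orbit_self)

lemma vertex_of_cong: "vertex_of y = vertex_of x \<longleftrightarrow> y \<in> vertex_of x"
  using vertex_of_eq gen_orbit_self by fast

lemma edge_of_cong: "edge_of y = edge_of x \<longleftrightarrow> y \<in> edge_of x"
  using edge_of_eq gen_orbit_self by fast

lemma vertex_of_flags: "y \<in> vertex_of x \<Longrightarrow> x \<in> flags M \<Longrightarrow> y \<in> flags M"
  using gen_orbit_subset[where A = "flags M" and S = "{r1 M, r2 M}", OF gens] by fastforce

lemma vertex_of_in [simp]: "x \<in> flags M \<Longrightarrow> vertex_of x \<in> vertices M"
  and edge_of_in [simp]: "x \<in> flags M \<Longrightarrow> edge_of x \<in> edges M"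
  and dart_of_in [simp]: "x \<in> flags M \<Longrightarrow> dart_of x \<in> darts M"
  by (auto simp: vertices_def edges_def darts_def)

lemma endvertices_edge_of:
  assumes "x \<in> flags M"
  shows "endvertices M (edge_of x) = {vertex_of x, vertex_of (r0 M x)}"
proof
  show "endvertices M (edge_of x) \<subseteq> {vertex_of x, vertex_of (r0 M x)}"
  proof
    fix v assume "v \<in> endvertices M (edge_of x)"
    then obtain y z where y: "v = vertex_of y" "z \<in> vertex_of y" "z \<in> edge_of x"
      by (auto simp: endvertices_def vertices_def)
    then have "v = vertex_of z" using vertex_of_cong by metis
    then show "v \<in> {vertex_of x, vertex_of (r0 M x)}" using y(3) by (auto simp: edge_of_iff)
  qed
  have "x \<in> vertex_of x \<inter> edge_of x" "r0 M x \<in> vertex_of (r0 M x) \<inter> edge_of x"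
    by (auto simp: gen_orbit_self edge_of_iff)
  then show "{vertex_of x, vertex_of (r0 M x)} \<subseteq> endvertices M (edge_of x)"
    using assms by (auto simp: endvertices_def)
qed

text \<open>The other half of the edge, the dart of \<open>r0 x\<close>, lies in the other endvertex.\<close>
lemma edge_meets_vertex:
  assumes "vertex_of (r0 M x) \<noteq> vertex_of x" "y \<in> edge_of x" "y \<in> vertex_of x"
  shows "y = x \<or> y = r2 M x"
proof -
  have "vertex_of y = vertex_of x" using assms(3) by (simp add: vertex_of_cong)
  moreover have "y \<in> {x, r2 M x, r0 M x, r2 M (r0 M x)}"
    using assms(2) by (simp only: edge_of_iff)
  ultimately show ?thesis using assms(1) by fastforce
qed


section \<open>Rotation around a vertex\<close>

lemma rot_permutes: "rot permutes flags M"
  using gens by (intro permutes_compose) auto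

lemma rot_inj: "inj (rot ^^ j)"
  using permutes_inj[OF rot_permutes] by (rule inj_fn)

lemma rot_flags [simp]: "(rot ^^ j) x \<in> flags M \<longleftrightarrow> x \<in> flags M"
  by (induction j) auto

lemma vertex_of_rot [simp]: "vertex_of ((rot ^^ j) x) = vertex_of x"
  by (induction j) auto

text \<open>The dihedral relation: conjugation by \<open>r2\<close> inverts rotation.  In this form it needs no inverses.\<close>
lemma rot_r2_rot: "(rot ^^ j) (r2 M ((rot ^^ j) x)) = r2 M x"
proof (induction j arbitrary: x)
  case (Suc j)
  have "(rot ^^ Suc j) (r2 M ((rot ^^ Suc j) x))
      = rot ((rot ^^ j) (r2 M ((rot ^^ j) (rot x))))"
    by (metis comp_apply funpow.simps(2) funpow_swap1)
  also have "\<dots> = r2 M x" by (simp only: Suc.IH) simp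
  finally show ?case .
qed simp

lemma rot_inverse:
  obtains i where "\<And>x. (rot ^^ i) ((rot ^^ j) x) = x"
  using permutes_power_inverse[OF rot_permutes fin] by blast

text \<open>Exponents can be kept non-negative because rotation has finite order.\<close>
lemma vertex_of_cases:
  assumes "y \<in> vertex_of x"
  obtains j where "y = (rot ^^ j) x \<or> y = r2 M ((rot ^^ j) x)"
proof -
  obtain N where N: "\<And>x. (rot ^^ N) ((rot ^^ 1) x) = x" using rot_inverse[of 1] by blast
  let ?A = "range (\<lambda>j. (rot ^^ j) x) \<union> range (\<lambda>j. r2 M ((rot ^^ j) x))"
  have "vertex_of x \<subseteq> ?A"
  proof (rule gen_orbit_subset[OF gens])
    have "(rot ^^ 0) x = x" by simp
    then show "x \<in> ?A" by (metis UnI1 rangeI)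
    fix s z assume s: "s \<in> {r1 M, r2 M}" and "z \<in> ?A"
    then consider j where "z = (rot ^^ j) x" | j where "z = r2 M ((rot ^^ j) x)" by blast
    then show "s z \<in> ?A"
    proof cases
      case 1
      have "r1 M z = r2 M ((rot ^^ Suc j) x)" using 1 by simp
      then show ?thesis using s 1 by blast
    next
      case 2
      have "rot (r1 M z) = (rot ^^ j) x" using 2 by simp
      then have "r1 M z = (rot ^^ (N + j)) x"
        using N[of "r1 M z"] by (simp add: funpow_add)
      then show ?thesis using s 2 by auto
    qed
  qed auto
  then show ?thesis using assms that by blast
qed

text \<open>The rotations and the reflections of a vertex do not mix: a coincidence would, after moving
  half the way, give a fixed point of \<open>r1\<close> or of \<open>r2\<close>.\<close>
lemma r2_neq_rot:
  assumes "x \<in> flags M"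
  shows "r2 M x \<noteq> (rot ^^ j) x"
proof
  assume eq: "r2 M x = (rot ^^ j) x"
  \<comment> \<open>The parity of \<open>j\<close> decides whether the flag \<open>w\<close> half-way is fixed by \<open>r2\<close> or by \<open>r1\<close>.\<close>
  define i w where "i = j div 2" and "w = (rot ^^ i) x"
  have w: "w \<in> flags M" using assms by (simp add: w_def)
  have "(rot ^^ i) (r2 M w) = (rot ^^ j) x"
    using rot_r2_rot[of i x] eq by (simp add: w_def)
  also have "j = i + (j mod 2 + i)" unfolding i_def by presburger
  then have "(rot ^^ j) x = (rot ^^ i) ((rot ^^ (j mod 2)) w)"
    unfolding w_def by (metis comp_apply funpow_add)
  finally have "r2 M w = (rot ^^ (j mod 2)) w" using rot_inj by (meson injD)
  moreover have "j mod 2 = 0 \<or> j mod 2 = 1" by auto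
  ultimately have "r2 M w = w \<or> r2 M (r2 M w) = r2 M (r2 M (r1 M w))" by auto
  then show False using r_neq[OF w] by auto
qed

lemma r2_rot_neq_rot:
  assumes "x \<in> flags M"
  shows "r2 M ((rot ^^ i) x) \<noteq> (rot ^^ j) x"
proof -
  obtain k where k: "\<And>x. (rot ^^ k) ((rot ^^ i) x) = x" using rot_inverse[of i] by blast
  have "r2 M ((rot ^^ i) x) \<noteq> (rot ^^ (j + k)) ((rot ^^ i) x)"
    using r2_neq_rot assms by simp
  then show ?thesis by (simp add: funpow_add k)
qed

text \<open>As long as rotation has not come back to \<open>x\<close>, it meets a new dart at each step, so the
  number of steps is less than the valence.\<close>
lemma less_valence:
  assumes x: "x \<in> flags M" and d: "\<And>j. 1 \<le> j \<Longrightarrow> j \<le> d \<Longrightarrow> (rot ^^ j) x \<noteq> x"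
  shows "d < valence M (vertex_of x)"
proof -
  let ?D = "\<lambda>j. dart_of ((rot ^^ j) x)"
  have neq: "?D i \<noteq> ?D j" if "i < j" "j \<le> d" for i j
  proof
    assume "?D i = ?D j"
    then have "(rot ^^ j) x \<in> ?D i" using gen_orbit_self by metis
    then have "(rot ^^ i) ((rot ^^ (j - i)) x) = (rot ^^ i) x"
      using r2_rot_neq_rot[OF x, of i j] that
      by (auto simp: dart_of_iff simp flip: comp_apply[of "rot ^^ i" "rot ^^ (j - i)"] funpow_add)
    then have "(rot ^^ (j - i)) x = x" using rot_inj by (meson injD)
    then show False using d[of "j - i"] that by auto
  qed
  have "inj_on ?D {0..d}"
    by (rule linorder_inj_onI) (use neq in auto)
  then have card: "card (?D ` {0..d}) = Suc d" by (simp add: card_image)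
  have sub: "?D ` {0..d} \<subseteq> {D \<in> darts M. D \<subseteq> vertex_of x}"
  proof clarify
    fix j
    have "(rot ^^ j) x \<in> vertex_of x" using vertex_of_cong vertex_of_rot by metis
    then have "?D j \<subseteq> vertex_of x" by (auto simp: dart_of_iff intro: gen_orbit_closed)
    then show "?D j \<in> darts M \<and> ?D j \<subseteq> vertex_of x" using x by simp
  qed
  have "finite (darts M)" unfolding darts_def using fin by (rule finite_imageI)
  then have "finite {D \<in> darts M. D \<subseteq> vertex_of x}" by (rule rev_finite_subset) (rule Collect_restrict)
  from card_mono[OF this sub] show ?thesis unfolding card valence_def by (rule Suc_le_lessD)
qed

text \<open>The second flag demanded by \<open>subtend\<close>, at exponent \<open>d - 1\<close>, is the other half of the dart reached
  after \<open>d\<close> steps, so only one edge has to be checked.\<close>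
lemma subtendI:
  assumes x: "x \<in> flags M" and d: "1 \<le> d"
    and neq: "\<And>j. 1 \<le> j \<Longrightarrow> j \<le> d \<Longrightarrow> (rot ^^ j) x \<noteq> x"
    and e: "x \<in> e" "e \<in> edges M"
    and e': "edge_of ((rot ^^ d) x) = e'"
  shows "subtend M d (vertex_of x) e e'"
proof -
  have valence: "d < valence M (vertex_of x)" by (rule less_valence[OF x neq])
  obtain c where c: "d = Suc c" using d by (cases d) auto
  have "r1 M ((rot ^^ (d - 1)) x) = r2 M ((rot ^^ d) x)" by (simp add: c)
  then have "(rot ^^ d) x \<in> e' \<and> r1 M ((rot ^^ (d - 1)) x) \<in> e'" "e' \<in> edges M"
    using x unfolding e'[symmetric] by (auto simp: edge_of_iff simp del: funpow.simps)
  moreover have "x \<in> e \<inter> vertex_of x" using e(1) gen_orbit_self by (rule IntI)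
  ultimately show ?thesis
    unfolding subtend_def using x d e(2) valence by (metis vertex_of_in)
qed


section \<open>Automorphisms\<close>

definition aut :: "('f \<Rightarrow> 'f) \<Rightarrow> bool" where
  "aut f \<longleftrightarrow> f \<in> carrier (Aut M)"

lemma aut_permutes: "aut f \<Longrightarrow> f permutes flags M"
  by (simp add: aut_def Aut_def)

lemma aut_r:
  "aut f \<Longrightarrow> f (r0 M x) = r0 M (f x)" "aut f \<Longrightarrow> f (r1 M x) = r1 M (f x)"
  "aut f \<Longrightarrow> f (r2 M x) = r2 M (f x)"
  by (auto simp: aut_def Aut_def fun_eq_iff)

lemma aut_rot: "aut f \<Longrightarrow> f ((rot ^^ j) x) = (rot ^^ j) (f x)"
  using funpow_comm[of f rot 1] by (simp add: aut_r)

lemma aut_inj: "aut f \<Longrightarrow> f x = f y \<longleftrightarrow> x = y"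
  by (meson aut_permutes injD permutes_inj)

lemma aut_flags [simp]: "aut f \<Longrightarrow> f x \<in> flags M \<longleftrightarrow> x \<in> flags M"
  using aut_permutes permutes_in_image by metis

lemma aut_funpow: "aut f \<Longrightarrow> aut (f ^^ i)"
  unfolding aut_def Aut_def
  by (auto simp: permutes_funpow fun_eq_iff intro!: funpow_comm[of f _ _ 1, simplified])

lemma Aut_pow:
  assumes "aut f"
  shows "f [^]\<^bsub>Aut M\<^esub> (i::nat) = f ^^ i"
proof -
  interpret group "Aut M" by (rule group_Aut)
  have mult: "p \<otimes>\<^bsub>Aut M\<^esub> p' = p' \<circ> p" for p p'
    by (simp add: Aut_def perm_group_def)
  have one: "\<one>\<^bsub>Aut M\<^esub> = id" by (simp add: Aut_def perm_group_def)
  show ?thesis by (induction i) (simp_all add: one mult)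
qed

lemma aut_vertex_of: "aut f \<Longrightarrow> f ` vertex_of x = vertex_of (f x)"
  by (rule gen_orbit_image[OF gens]) (auto simp: aut_r)

lemma aut_edge_of: "aut f \<Longrightarrow> f ` edge_of x = edge_of (f x)"
  by (rule gen_orbit_image[OF gens]) (auto simp: aut_r)

lemma aut_dart_of: "aut f \<Longrightarrow> f ` dart_of x = dart_of (f x)"
  by (rule gen_orbit_image[OF gens]) (auto simp: aut_r)

lemma aut_vertex_iff: "aut f \<Longrightarrow> vertex_of (f x) = vertex_of (f y) \<longleftrightarrow> vertex_of x = vertex_of y"
  using inj_image_eq_iff[OF permutes_inj[OF aut_permutes], of f "vertex_of x" "vertex_of y"]
  by (simp add: aut_vertex_of)

lemma aut_edge_iff: "aut f \<Longrightarrow> edge_of (f x) = edge_of (f y) \<longleftrightarrow> edge_of x = edge_of y"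
  using inj_image_eq_iff[OF permutes_inj[OF aut_permutes], of f "edge_of x" "edge_of y"]
  by (simp add: aut_edge_of)

lemma flags_connected:
  assumes "x \<in> flags M" "x \<in> A" "\<And>s y. s \<in> {r0 M, r1 M, r2 M} \<Longrightarrow> y \<in> A \<Longrightarrow> s y \<in> A"
  shows "flags M \<subseteq> A"
proof
  fix y assume "y \<in> flags M"
  then have "y \<in> gen_orbit (flags M) {r0 M, r1 M, r2 M} x"
    using map assms(1) by (auto simp: is_map_def)
  moreover have "gen_orbit (flags M) {r0 M, r1 M, r2 M} x \<subseteq> A"
    using gens assms(2,3) by (rule gen_orbit_subset)
  ultimately show "y \<in> A" by blast
qed

text \<open>The flags fixed by an automorphism are closed under \<open>r0\<close>, \<open>r1\<close>, \<open>r2\<close>, hence none or all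
  by connectedness.\<close>
lemma aut_fix:
  assumes f: "aut f" and x: "x \<in> flags M" "f x = x"
  shows "f = id"
proof
  have "flags M \<subseteq> {y. f y = y}"
    by (rule flags_connected[OF x(1)]) (use f x(2) in \<open>auto simp: aut_r\<close>)
  then show "f y = id y" for y
    using aut_permutes[OF f] by (cases "y \<in> flags M") (auto simp: permutes_not_in)
qed

text \<open>If one edge were a loop then, by dart-transitivity, all edges would be loops, and a
  connected map all of whose edges are loops has a single vertex.\<close>
lemma no_loops:
  assumes dt: "dart_transitive M" and two: "2 \<le> card (vertices M)" and x: "x \<in> flags M"
  shows "vertex_of (r0 M x) \<noteq> vertex_of x"
proof
  assume loop: "vertex_of (r0 M x) = vertex_of x"
  have all: "vertex_of (r0 M y) = vertex_of y" if y: "y \<in> flags M" for y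
  proof -
    obtain f where f: "aut f" "f ` dart_of x = dart_of y"
      using dt dart_of_in[OF x] dart_of_in[OF y] unfolding dart_transitive_def aut_def by blast
    then have "y \<in> dart_of (f x)" using aut_dart_of gen_orbit_self by metis
    moreover have "vertex_of (r0 M (f x)) = vertex_of (f x)"
      using loop f(1) aut_vertex_iff aut_r(1) by metis
    ultimately show ?thesis by (auto simp: dart_of_iff simp flip: r2_r0)
  qed
  have "flags M \<subseteq> {y \<in> flags M. vertex_of y = vertex_of x}"
    by (rule flags_connected[OF x]) (use x all in auto)
  then have "vertices M \<subseteq> {vertex_of x}" by (auto simp: vertices_def)
  then have "card (vertices M) \<le> card {vertex_of x}" by (intro card_mono) auto
  then show False using two by simp
qed


section \<open>Edges spread evenly around a vertex\<close>

text \<open>\<open>meets h j y\<close> with \<open>j \<ge> 1\<close> says that rotating \<open>y\<close> by \<open>j\<close> steps returns to the orbit of \<open>y\<close> under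
  the powers of \<open>h\<close>; for \<open>h = id\<close> it says that \<open>j\<close> steps of rotation fix \<open>y\<close>.\<close>
definition meets :: "('f \<Rightarrow> 'f) \<Rightarrow> nat \<Rightarrow> 'f \<Rightarrow> bool" where
  "meets h j y \<longleftrightarrow> (\<exists>b. (rot ^^ j) y = (h ^^ b) y)"

text \<open>The first return to the orbit takes \<open>d\<close> steps, and at that moment \<open>y\<close> itself has not been reached
  again.  The last clause guarantees that \<open>d\<close> is less than the valence, as \<open>subtend\<close> requires.\<close>
definition spacing :: "('f \<Rightarrow> 'f) \<Rightarrow> nat \<Rightarrow> 'f \<Rightarrow> bool" where
  "spacing h d y \<longleftrightarrow>
     1 \<le> d \<and> meets h d y \<and> (\<forall>j. 1 \<le> j \<and> j < d \<longrightarrow> \<not> meets h j y) \<and> \<not> meets id d y"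

lemma aut_id: "aut id"
  by (simp add: aut_def Aut_def permutes_id)

lemma meets_id: "meets id j y \<longleftrightarrow> (rot ^^ j) y = y"
  by (simp add: meets_def)

text \<open>The relation \<open>meets\<close> is an equation between commuting operations on \<open>y\<close>, so it is unaffected
  by replacing \<open>y\<close> by its image under any injective map that commutes with both rotation and \<open>h\<close>.\<close>
lemma meets_rot:
  assumes h: "aut h"
  shows "meets h j ((rot ^^ i) y) \<longleftrightarrow> meets h j y"
proof -
  have "(rot ^^ j) ((rot ^^ i) y) = (rot ^^ i) ((rot ^^ j) y)" by (rule funpow_comm) simp
  moreover have "(h ^^ b) ((rot ^^ i) y) = (rot ^^ i) ((h ^^ b) y)" for b
    by (rule aut_rot[OF aut_funpow[OF h]])
  ultimately show ?thesis by (simp add: meets_def inj_eq[OF rot_inj])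
qed

lemma meets_aut:
  assumes f: "aut f" and hf: "\<And>z. h (f z) = f (h z)"
  shows "meets h j (f y) \<longleftrightarrow> meets h j y"
proof -
  have "(h ^^ b) (f y) = f ((h ^^ b) y)" for b by (induction b) (auto simp: hf)
  then show ?thesis by (simp add: meets_def aut_rot[OF f, symmetric] aut_inj[OF f])
qed

text \<open>Passing from \<open>y\<close> to \<open>r2 y\<close> reverses the direction of rotation.  This replaces the power of \<open>h\<close>
  by its inverse, which is again a power of \<open>h\<close>.\<close>
lemma meets_r2:
  assumes h: "aut h"
  shows "meets h j (r2 M y) \<longleftrightarrow> meets h j y"
proof -
  have *: "meets h j (r2 M y)" if m: "meets h j y" for y
  proof -
    obtain b where b: "(rot ^^ j) y = (h ^^ b) y" using m by (auto simp: meets_def)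
    obtain c where c: "\<And>z. (h ^^ c) ((h ^^ b) z) = z"
      using permutes_power_inverse[OF aut_permutes[OF h] fin] by blast
    note hb = aut_funpow[OF h, of b]
    have "(h ^^ b) ((rot ^^ j) (r2 M y)) = r2 M y"
      using rot_r2_rot[of j y] by (simp only: b aut_rot[OF hb] aut_r(3)[OF hb])
    then have "(rot ^^ j) (r2 M y) = (h ^^ c) (r2 M y)" using c by metis
    then show ?thesis by (auto simp: meets_def)
  qed
  show ?thesis using *[of y] *[of "r2 M y"] by auto
qed

text \<open>The spacing is the same all around a vertex.  It can therefore be carried from the flag at which a
  walk enters a vertex to the flag at which it leaves.\<close>
lemma spacing_vertex:
  assumes h: "aut h" and y: "y \<in> vertex_of x" and s: "spacing h d x"
  shows "spacing h d y"
proof -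
  obtain j where "y = (rot ^^ j) x \<or> y = r2 M ((rot ^^ j) x)" using vertex_of_cases[OF y] .
  then show ?thesis
    using s by (auto simp: spacing_def meets_rot[OF h] meets_rot[OF aut_id]
        meets_r2[OF h] meets_r2[OF aut_id] simp del: id_apply)
qed

lemma spacing_aut:
  assumes f: "aut f" and hf: "\<And>z. h (f z) = f (h z)" and s: "spacing h d x"
  shows "spacing h d (f x)"
proof -
  have "meets h j (f x) = meets h j x" for j using f hf by (rule meets_aut)
  moreover have "meets id j (f x) = meets id j x" for j by (rule meets_aut[OF f]) simp
  ultimately show ?thesis using s by (simp add: spacing_def)
qed

lemma spacing_neq:
  assumes "spacing h d y" "1 \<le> j" "j \<le> d"
  shows "(rot ^^ j) y \<noteq> y"
proof
  assume eq: "(rot ^^ j) y = y"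
  then have "meets h j y" unfolding meets_def by (intro exI[of _ 0]) simp
  moreover have "meets id j y" using eq by (simp add: meets_id)
  ultimately show False using assms by (cases "j = d") (auto simp: spacing_def)
qed

text \<open>An automorphism that acts on a vertex as a reflection of the cyclic order is an involution.\<close>
lemma rotates:
  assumes h: "aut h" and hx: "h x \<in> vertex_of x" and hh: "h (h x) \<noteq> x"
  obtains c where "h x = (rot ^^ c) x"
proof -
  obtain c where c: "h x = (rot ^^ c) x \<or> h x = r2 M ((rot ^^ c) x)"
    using vertex_of_cases[OF hx] .
  have False if r: "h x = r2 M ((rot ^^ c) x)"
  proof -
    have "h (h x) = r2 M ((rot ^^ c) (h x))"
      using r by (metis aut_r(3) aut_rot h)
    also have "\<dots> = x" by (simp only: r rot_r2_rot r_r)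
    finally show False using hh by simp
  qed
  then show ?thesis using c that by blast
qed

lemma rotates_pow:
  assumes h: "aut h" and c: "h x = (rot ^^ c) x"
  shows "(h ^^ a) x = (rot ^^ (c * a)) x"
proof (induction a)
  case (Suc a)
  have "(h ^^ Suc a) x = (rot ^^ (c * a)) (h x)"
    by (simp only: funpow.simps comp_apply[of h] Suc.IH aut_rot[OF h])
  also have "\<dots> = (rot ^^ (c * Suc a)) x"
    by (simp only: c mult_Suc_right add.commute[of c] funpow_add comp_apply)
  finally show ?case .
qed simp

text \<open>The image of \<open>x\<close> under \<open>h\<close> is reached by rotation in some number \<open>c\<close> of steps, and \<open>c\<close> may be
  chosen before the first return to \<open>x\<close>; the least return to the orbit comes no later than \<open>c\<close>.\<close>
lemma spacing_exists:
  assumes h: "aut h" and hx: "h x \<in> vertex_of x" and hh: "h (h x) \<noteq> x"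
  obtains d where "spacing h d x"
proof -
  define c where "c = (LEAST c. (rot ^^ c) x = h x)"
  define d where "d = (LEAST d. 1 \<le> d \<and> meets h d x)"
  obtain c' where "h x = (rot ^^ c') x" using rotates[OF h hx hh] .
  then have c: "(rot ^^ c) x = h x"
    unfolding c_def by (metis (mono_tags, lifting) LeastI)
  have "c \<noteq> 0"
  proof
    assume "c = 0"
    then have "h x = x" using c by simp
    then show False using hh by simp
  qed
  moreover have "meets h c x" unfolding meets_def using c by (intro exI[of _ 1]) simp
  ultimately have cc: "1 \<le> c \<and> meets h c x" by simp
  have d: "1 \<le> d \<and> meets h d x" unfolding d_def by (rule LeastI[of _ c]) (rule cc)
  have dc: "d \<le> c" unfolding d_def by (rule Least_le[of "\<lambda>d. 1 \<le> d \<and> meets h d x"]) (rule cc)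
  have "(rot ^^ d) x \<noteq> x"
  proof
    assume "(rot ^^ d) x = x"
    then have "(rot ^^ (c - d)) x = (rot ^^ (c - d)) ((rot ^^ d) x)" by simp
    also have "\<dots> = (rot ^^ (c - d + d)) x" by (simp only: funpow_add comp_apply)
    also have "\<dots> = h x" using c dc by simp
    finally have "c \<le> c - d" unfolding c_def by (rule Least_le)
    then show False using d dc by linarith
  qed
  moreover have "\<not> meets h j x" if "1 \<le> j \<and> j < d" for j
    using that not_less_Least[of j "\<lambda>d. 1 \<le> d \<and> meets h d x"] by (auto simp: d_def)
  ultimately have "spacing h d x" using d by (simp add: spacing_def meets_id)
  then show ?thesis by (rule that)
qed

lemma aut_vertex_pow:
  assumes h: "aut h" and hz: "h z \<in> vertex_of z"
  shows "vertex_of ((h ^^ b) z) = vertex_of z"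
proof (induction b)
  case (Suc b)
  then have "vertex_of (h ((h ^^ b) z)) = vertex_of (h z)" by (simp only: aut_vertex_iff[OF h])
  then show ?case using hz by (simp only: vertex_of_cong[symmetric] funpow.simps comp_apply)
qed simp

text \<open>The flags of the edges of the orbit that lie in the vertex are those of the \<open>h\<close>-orbits of
  \<open>z\<close> and \<open>r2 z\<close>.  Rotating from a flag of the first orbit one never meets the second one, so the
  first edge met is reached after exactly the number of steps measured by \<open>spacing\<close>.\<close>
lemma consecutive_orbit_subtend:
  assumes z: "z \<in> flags M" and noloop: "vertex_of (r0 M z) \<noteq> vertex_of z"
    and h: "aut h" and hz: "h z \<in> vertex_of z" and hh: "h (h z) \<noteq> z"
    and sp: "spacing h d z"
    and cons: "consecutive M (vertex_of z) (range (\<lambda>b. edge_of ((h ^^ b) z))) e e'"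
  shows "subtend M d (vertex_of z) e e'"
proof -
  let ?B = "range (\<lambda>b. edge_of ((h ^^ b) z))"
  note hb = aut_funpow[OF h]
  have flags: "w = (h ^^ b) z \<or> w = r2 M ((h ^^ b) z)"
    if "w \<in> edge_of ((h ^^ b) z)" "w \<in> vertex_of z" for w b
  proof (rule edge_meets_vertex)
    show "vertex_of (r0 M ((h ^^ b) z)) \<noteq> vertex_of ((h ^^ b) z)"
      using noloop by (simp only: aut_r(1)[OF hb, symmetric] aut_vertex_iff[OF hb] not_False_eq_True)
    show "w \<in> vertex_of ((h ^^ b) z)" using that(2) by (simp only: aut_vertex_pow[OF h hz])
  qed (rule that(1))
  obtain x j where x: "x \<in> e" "x \<in> vertex_of z" and j: "1 \<le> j" "(rot ^^ j) x \<in> e'"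
    and first: "\<And>i. 1 \<le> i \<Longrightarrow> i < j \<Longrightarrow> (rot ^^ i) x \<notin> \<Union>?B"
    and e: "e \<in> ?B" and e': "e' \<in> ?B"
    using cons unfolding consecutive_def by blast
  obtain b where b: "e = edge_of ((h ^^ b) z)" using e by blast
  obtain b' where b': "e' = edge_of ((h ^^ b') z)" using e' by blast
  have xF: "x \<in> flags M" using vertex_of_flags[OF x(2) z] .
  have vx: "vertex_of x = vertex_of z" using x(2) by (simp only: vertex_of_cong)
  have spx: "spacing h d x" using spacing_vertex[OF h x(2) sp] .
  have hx: "h x \<in> vertex_of x"
    using hz aut_vertex_iff[OF h, of x z] by (simp only: vertex_of_cong[symmetric] vx)
  have xz: "x = (h ^^ b) z \<or> x = r2 M ((h ^^ b) z)" using flags x b by blast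
  have hhx: "h (h x) \<noteq> x"
  proof
    assume "h (h x) = x"
    then have "h \<circ> h = id"
      using aut_fix[OF aut_funpow[OF h, of 2] xF] by (simp add: numeral_2_eq_2)
    then show False using hh by (simp add: fun_eq_iff)
  qed
  obtain c where c: "\<And>w. (h ^^ c) ((h ^^ b) w) = w"
    using permutes_power_inverse[OF aut_permutes[OF h] fin] by blast
  have zx: "z = (h ^^ c) x \<or> z = r2 M ((h ^^ c) x)"
    using xz c by (auto simp: aut_r(3)[OF hb])
  have "\<exists>a. (rot ^^ d) x = (h ^^ a) x" using spx by (auto simp: spacing_def meets_def)
  then obtain a where a: "(rot ^^ d) x = (h ^^ a) x" ..
  have "(h ^^ a) x \<in> (h ^^ a) ` edge_of ((h ^^ b) z)" using x b by blast
  then have "(rot ^^ d) x \<in> edge_of ((h ^^ (a + b)) z)"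
    by (simp only: a aut_edge_of[OF hb] funpow_add comp_apply)
  then have "(rot ^^ d) x \<in> \<Union>?B" by blast
  moreover have "1 \<le> d" using spx by (simp add: spacing_def)
  ultimately have jd: "j \<le> d" using first not_le by blast
  have "(rot ^^ j) x \<in> vertex_of z"
    using vx by (simp only: vertex_of_cong[symmetric] vertex_of_rot)
  then have "(rot ^^ j) x = (h ^^ b') z \<or> (rot ^^ j) x = r2 M ((h ^^ b') z)"
    using flags j(2) b' by blast
  then have "(rot ^^ j) x = (h ^^ (b' + c)) x \<or> (rot ^^ j) x = r2 M ((h ^^ (b' + c)) x)"
    using zx by (auto simp: aut_r(3)[OF hb] funpow_add)
  moreover obtain c' where "h x = (rot ^^ c') x" using rotates[OF h hx hhx] .
  then have "(h ^^ (b' + c)) x = (rot ^^ (c' * (b' + c))) x" by (rule rotates_pow[OF h])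
  ultimately have "(rot ^^ j) x = (h ^^ (b' + c)) x"
    using r2_rot_neq_rot[OF xF] by metis
  then have "meets h j x" by (auto simp: meets_def)
  then have "j = d" using jd j(1) spx by (auto simp: spacing_def)
  then have "edge_of ((rot ^^ d) x) = e'" using j(2) b' by (simp only: edge_of_cong)
  then have "subtend M d (vertex_of x) e e'"
    using z b hb spx x by (intro subtendI xF spacing_neq[OF spx]) (auto simp: spacing_def)
  then show ?thesis by (simp only: vx)
qed

text \<open>At either end of the edge of \<open>y\<close>, the orbit of that edge is evenly spread, by the preceding lemma
  applied to \<open>y\<close> and to \<open>r0 y\<close>.  The two spacings are assumed to agree; along a walk they do because
  of \<open>spacing_vertex\<close>.\<close>
lemma orbit_bead:
  assumes y: "y \<in> flags M" and noloop: "vertex_of (r0 M y) \<noteq> vertex_of y"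
    and h: "aut h" and hy: "h y \<in> vertex_of y" "h (r0 M y) \<in> vertex_of (r0 M y)"
    and hh: "h (h y) \<noteq> y" and edge: "edge_of (h y) \<noteq> edge_of y"
    and sp: "spacing h d y" "spacing h d (r0 M y)"
  shows "bead_between M d (vertex_of y) (vertex_of (r0 M y)) (range (\<lambda>b. edge_of ((h ^^ b) y)))"
    (is "bead_between M d ?u ?v ?B")
proof -
  note hb = aut_funpow[OF h]
  have "endvertices M (edge_of ((h ^^ b) y)) = {?u, ?v}" for b
  proof -
    have "r0 M ((h ^^ b) y) = (h ^^ b) (r0 M y)" by (simp only: aut_r(1)[OF hb])
    then show ?thesis
      using endvertices_edge_of[of "(h ^^ b) y"] y aut_vertex_pow[OF h hy(1), of b]
        aut_vertex_pow[OF h hy(2), of b] hb by simp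
  qed
  then have ends: "\<forall>e\<in>?B. endvertices M e = {?u, ?v}" by blast
  have two: "\<exists>e\<in>?B. \<exists>e'\<in>?B. e \<noteq> e'"
  proof -
    have "(h ^^ 0) y = y" "(h ^^ 1) y = h y" by simp_all
    then have "edge_of y \<in> ?B" "edge_of (h y) \<in> ?B" by (metis rangeI)+
    then show ?thesis using edge by blast
  qed
  \<comment> \<open>The conditions on \<open>h\<close> pass from \<open>y\<close> to the other end \<open>r0 y\<close> of the edge.\<close>
  have hh': "h (h (r0 M y)) \<noteq> r0 M y"
  proof
    assume "h (h (r0 M y)) = r0 M y"
    then have "r0 M (r0 M (h (h y))) = r0 M (r0 M y)" by (simp only: aut_r(1)[OF h])
    then show False using hh by simp
  qed
  have B: "range (\<lambda>b. edge_of ((h ^^ b) (r0 M y))) = ?B"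
    by (simp only: aut_r(1)[OF hb] edge_of_r)
  have u: "subtend M d ?u e e'" if "consecutive M ?u ?B e e'" for e e'
    using consecutive_orbit_subtend[OF y noloop h hy(1) hh sp(1) that] .
  have v: "subtend M d ?v e e'" if "consecutive M ?v ?B e e'" for e e'
    by (rule consecutive_orbit_subtend[OF _ _ h hy(2) hh' sp(2)])
      (use y noloop that in \<open>auto simp only: B r_flags r_r\<close>)
  show ?thesis
    unfolding bead_between_def
  proof (intro conjI)
    show "?u \<noteq> ?v" using noloop by (rule not_sym)
    show "?B \<subseteq> edges M" using y hb by auto
    show "\<forall>w\<in>{?u, ?v}. \<forall>e e'. consecutive M w ?B e e' \<longrightarrow> subtend M d w e e'"
      using u v by blast
  qed (rule two, rule ends)
qed

text \<open>The least number of steps from \<open>y\<close> to the edge of \<open>h y\<close> cannot include a full turn, since a full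
  turn could be removed.\<close>
lemma subtend_exists:
  assumes h: "aut h" and hy: "h y \<in> vertex_of y" and edge: "edge_of (h y) \<noteq> edge_of y"
  obtains d where "1 \<le> d" "\<And>j. 1 \<le> j \<Longrightarrow> j \<le> d \<Longrightarrow> (rot ^^ j) y \<noteq> y"
    "edge_of ((rot ^^ d) y) = edge_of (h y)"
proof -
  define d where "d = (LEAST c. edge_of ((rot ^^ c) y) = edge_of (h y))"
  obtain c where "h y = (rot ^^ c) y \<or> h y = r2 M ((rot ^^ c) y)" using vertex_of_cases[OF hy] .
  then have "edge_of ((rot ^^ c) y) = edge_of (h y)" by (elim disjE) (simp_all only: edge_of_r)
  then have d: "edge_of ((rot ^^ d) y) = edge_of (h y)" unfolding d_def by (rule LeastI)
  have "d \<noteq> 0" using d edge by (cases d) auto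
  moreover have "(rot ^^ j) y \<noteq> y" if "1 \<le> j" "j \<le> d" for j
  proof
    assume "(rot ^^ j) y = y"
    then have "(rot ^^ (d - j)) y = (rot ^^ (d - j)) ((rot ^^ j) y)" by simp
    also have "\<dots> = (rot ^^ (d - j + j)) y" by (simp only: funpow_add comp_apply)
    finally have "edge_of ((rot ^^ (d - j)) y) = edge_of (h y)" using d that by simp
    then have "d \<le> d - j" unfolding d_def by (rule Least_le)
    then show False using that by simp
  qed
  ultimately show ?thesis using d by (intro that[of d]) auto
qed

end


section \<open>The walk generated by a flag and an automorphism\<close>

text \<open>The walk consists of the images of the flag \<open>x\<close> under the powers of \<open>g\<close>, and \<open>k\<close> is the
  number of steps after which it first comes back to the vertex of \<open>x\<close>.  Since \<open>g\<close> moves the whole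
  walk one step forward, anything known at the first flag holds at all of them.\<close>
locale consistent_walk = finite_map M for M :: "'f flag_map" +
  fixes x :: 'f and g :: "'f \<Rightarrow> 'f" and k :: nat
  assumes noloop: "\<And>y. y \<in> flags M \<Longrightarrow> vertex_of (r0 M y) \<noteq> vertex_of y"
    and x: "x \<in> flags M" and g: "aut g"
    and step: "vertex_of (g x) = vertex_of (r0 M x)"
    and no_backtrack: "g x \<notin> dart_of (r0 M x)"
    and k: "1 \<le> k" "vertex_of ((g ^^ k) x) = vertex_of x"
    and k_least: "\<And>s. 1 \<le> s \<Longrightarrow> s < k \<Longrightarrow> vertex_of ((g ^^ s) x) \<noteq> vertex_of x"
begin

definition y :: "nat \<Rightarrow> 'f" where "y i = (g ^^ i) x"
definition v :: "nat \<Rightarrow> 'f set" where "v i = vertex_of (y i)"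
definition e :: "nat \<Rightarrow> 'f set" where "e i = edge_of (y i)"
definition h :: "'f \<Rightarrow> 'f" where "h = g ^^ k"

lemma gi: "aut (g ^^ i)"
  by (rule aut_funpow[OF g])

lemma h: "aut h"
  unfolding h_def by (rule gi)

lemma y_flags [simp]: "y i \<in> flags M"
  using x gi by (simp add: y_def)

lemma y_add: "y (i + j) = (g ^^ i) (y j)"
  by (simp add: y_def funpow_add)

lemma h_y: "h (y i) = y (i + k)"
  unfolding h_def by (subst add.commute) (simp only: y_add)

lemma v_r0: "vertex_of (r0 M (y i)) = v (Suc i)"
proof -
  have "vertex_of ((g ^^ i) (g x)) = vertex_of ((g ^^ i) (r0 M x))"
    using step by (simp only: aut_vertex_iff[OF gi])
  then show ?thesis by (simp add: v_def y_def aut_r(1)[OF gi] funpow_swap1)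
qed

lemma v_add_iff: "v (i + s) = v (i + t) \<longleftrightarrow> v s = v t"
  unfolding v_def y_add by (rule aut_vertex_iff[OF gi])

lemma e_add_iff: "e (i + s) = e (i + t) \<longleftrightarrow> e s = e t"
  unfolding e_def y_add by (rule aut_edge_iff[OF gi])

lemma v_k [simp]: "v (i + k) = v i"
  using k(2) v_add_iff[of i k 0] by (simp add: v_def y_def)

lemma v_neq_0: "1 \<le> s \<Longrightarrow> s < k \<Longrightarrow> v s \<noteq> v 0"
  using k_least by (simp add: v_def y_def)

lemma v_inj: "i < j \<Longrightarrow> j < k \<Longrightarrow> v i \<noteq> v j"
  using v_neq_0[of "j - i"] v_add_iff[of i "j - i" 0] by auto

lemma v_Suc_neq: "v (Suc i) \<noteq> v i"
  using noloop[of "y i"] by (simp add: v_r0) (simp add: v_def)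

lemma k2: "2 \<le> k"
proof (rule ccontr)
  assume "\<not> 2 \<le> k"
  then have "k = 1" using k(1) by simp
  then show False using v_k[of 0] v_Suc_neq[of 0] by simp
qed

lemma e_edges [simp]: "e i \<in> edges M" and v_vertices [simp]: "v i \<in> vertices M"
  by (simp_all add: e_def v_def)

lemma ends: "endvertices M (e i) = {v i, v (Suc i)}"
  unfolding e_def by (subst endvertices_edge_of) (simp_all only: y_flags v_r0, simp only: v_def)

text \<open>Two of the first \<open>k\<close> edges could only coincide if they are consecutive, and then the walk
  backtracks.\<close>
lemma e_inj:
  assumes "i < j" "j < k"
  shows "e i \<noteq> e j"
proof
  assume "e i = e j"
  define s where "s = j - i"
  have s: "1 \<le> s" "s < k" "j = i + s" using assms by (auto simp: s_def)
  have es: "e s = e 0" using \<open>e i = e j\<close> e_add_iff[of i s 0] s(3) by simp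
  then have "{v s, v (Suc s)} = {v 0, v (Suc 0)}" using ends[of s] ends[of 0] by simp
  then have "v s = v 1" using v_neq_0[OF s(1,2)] by auto
  then have "v (s - 1) = v 0" using v_add_iff[of 1 "s - 1" 0] s(1) by simp
  then have "s = 1" using v_neq_0[of "s - 1"] s by fastforce
  then have "edge_of (g x) = edge_of x" using es by (simp add: e_def y_def)
  then have gx: "g x \<in> {x, r2 M x, r0 M x, r2 M (r0 M x)}"
    by (simp only: edge_of_cong edge_of_iff)
  have "vertex_of (g x) \<noteq> vertex_of x" using step noloop[OF x] by simp
  then have "g x \<noteq> x \<and> g x \<noteq> r2 M x" by (metis vertex_of_r(2))
  then have "g x \<in> dart_of (r0 M x)" using gx by (auto simp: dart_of_iff)
  then show False using no_backtrack by simp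
qed

lemma closed_walk_upt:
  assumes "1 \<le> n" "v n = v 0"
  shows "closed_walk M (map v [0..<n]) (map e [0..<n])"
proof -
  have "v (Suc i) = v (Suc i mod n)" if "i < n" for i
    using that assms by (cases "Suc i = n") auto
  then show ?thesis using assms by (auto simp: closed_walk_def ends)
qed

lemma v_mod: "i < k \<Longrightarrow> v (Suc i mod k) = v (Suc i)"
  using v_k[of 0] by (cases "Suc i = k") auto

lemma cyclic: "cyclic_walk M (map v [0..<k]) (map e [0..<k])"
proof -
  have "inj_on v {0..<k}" "inj_on e {0..<k}"
    using v_inj e_inj by (auto intro!: linorder_inj_onI)
  then show ?thesis
    using closed_walk_upt[of k] k v_k[of 0] k2 by (simp add: cyclic_walk_def distinct_map)
qed

text \<open>If the edge of \<open>x\<close> is fixed by \<open>h\<close>, then the walk traverses the same cycle of \<open>k\<close> edges over and over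
  again.  Here \<open>h\<close> is the identity, or it reflects the map in this cycle.\<close>
lemma cycle_if_edge_fixed:
  assumes "e k = e 0"
  shows "is_cycle M (range e)"
proof -
  have "e (i + k) = e i" for i using assms e_add_iff[of i k 0] by simp
  then have "range e = set (map e [0..<k])" using range_periodic[of k e] k2 by simp
  then show ?thesis using cyclic unfolding is_cycle_def by blast
qed

lemma h_fixes_vertex: "h (y i) \<in> vertex_of (y i)"
  using v_k[of i] by (simp only: h_y v_def vertex_of_cong)

lemma h_fixes_vertex_r0: "h (r0 M (y i)) \<in> vertex_of (r0 M (y i))"
proof -
  have "vertex_of (r0 M (y (i + k))) = vertex_of (r0 M (y i))"
    using v_k[of "Suc i"] by (simp add: v_r0)
  then show ?thesis by (simp only: aut_r(1)[OF h] h_y vertex_of_cong)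
qed

lemma h_e: "h ` e i = e (i + k)"
  unfolding e_def by (simp only: aut_edge_of[OF h] h_y)

lemma h_v: "h ` v i = v i"
  using v_k[of i] unfolding v_def by (simp only: aut_vertex_of[OF h] h_y)

text \<open>The number of faces is found at one flag \<open>z\<close> and then transported by the powers of \<open>g\<close>, so it is
  the same number at all vertices of the walk.\<close>
lemma subtend_walk:
  assumes z: "z \<in> flags M" "h z \<in> vertex_of z" "edge_of (h z) \<noteq> edge_of z"
  obtains d where "\<And>i. subtend M d (vertex_of ((g ^^ i) z)) (edge_of ((g ^^ i) z))
    (edge_of ((g ^^ i) (h z)))"
proof -
  obtain d where d: "1 \<le> d" "\<And>j. 1 \<le> j \<Longrightarrow> j \<le> d \<Longrightarrow> (rot ^^ j) z \<noteq> z"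
    "edge_of ((rot ^^ d) z) = edge_of (h z)"
    using subtend_exists[OF h z(2,3)] by metis
  have "subtend M d (vertex_of ((g ^^ i) z)) (edge_of ((g ^^ i) z)) (edge_of ((g ^^ i) (h z)))" for i
  proof (rule subtendI)
    show "(g ^^ i) z \<in> flags M" using z gi by simp
    then show "edge_of ((g ^^ i) z) \<in> edges M" by simp
    show "(rot ^^ j) ((g ^^ i) z) \<noteq> (g ^^ i) z" if "1 \<le> j" "j \<le> d" for j
      using d(2)[OF that] by (simp only: aut_rot[OF gi, symmetric] aut_inj[OF gi] not_False_eq_True)
    show "edge_of ((rot ^^ d) ((g ^^ i) z)) = edge_of ((g ^^ i) (h z))"
      using d(3) by (simp only: aut_rot[OF gi, symmetric] aut_edge_iff[OF gi])
  qed (rule d(1), rule gen_orbit_self)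
  then show ?thesis by (rule that)
qed

text \<open>The symmetry of the twining is \<open>h\<close> itself: it fixes all vertices and, being an involution,
  interchanges \<open>e i\<close> with \<open>e (i + k)\<close>.  The two subtended numbers come from the flags \<open>x\<close> and \<open>r0 x\<close> at
  the two ends of the first edge.\<close>
lemma twining_if_involution:
  assumes neq: "e k \<noteq> e 0" and hh: "h \<circ> h = id"
  shows "is_twining M (range e)"
proof -
  let ?vs = "map v [0..<k]" and ?es = "map e [0..<k + k]"
  have per: "e (i + k + k) = e i" for i
  proof -
    have "h ` h ` e i = e i" by (simp only: image_comp hh image_id id_apply)
    then show ?thesis by (simp only: h_e)
  qed
  have y0: "y 0 = x" by (simp add: y_def)
  have hx: "edge_of (h x) \<noteq> edge_of x" using neq h_y[of 0] by (simp add: e_def y0)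
  obtain d where d: "\<And>i. subtend M d (vertex_of ((g ^^ i) x)) (edge_of ((g ^^ i) x))
      (edge_of ((g ^^ i) (h x)))"
    using subtend_walk[OF x _ hx] h_fixes_vertex[of 0] by (auto simp only: y0)
  have hx': "edge_of (h (r0 M x)) \<noteq> edge_of (r0 M x)"
    using hx by (simp only: aut_r(1)[OF h] edge_of_r not_False_eq_True)
  obtain d' where d': "\<And>i. subtend M d' (vertex_of ((g ^^ i) (r0 M x))) (edge_of ((g ^^ i) (r0 M x)))
      (edge_of ((g ^^ i) (h (r0 M x))))"
    using subtend_walk[OF _ _ hx'] h_fixes_vertex_r0[of 0] x by (auto simp only: y0 r_flags)
  have gh: "(g ^^ i) (h x) = y (i + k)" for i
    using h_y[of 0] by (simp only: y0 y_add add_0)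
  have sd: "subtend M d (v i) (e i) (e (i + k))" for i
    using d[of i] by (simp only: v_def e_def gh) (simp only: y_def)
  have sd': "subtend M d' (v (Suc i)) (e i) (e (i + k))" for i
    using d'[of i] by (simp only: aut_r(1)[OF h] aut_r(1)[OF gi] edge_of_r gh e_def)
      (simp only: y_def[symmetric] v_r0)
  have vs: "?vs @ ?vs = map v [0..<k + k]"
    by (rule nth_equalityI) (auto simp: nth_append simp flip: v_k[of "_ - k"])
  have "v (k + k) = v 0" using v_k[of k] v_k[of 0] by simp
  then have cw: "closed_walk M (?vs @ ?vs) ?es"
    unfolding vs using closed_walk_upt[of "k + k"] k(1) by simp
  have "twining M ?vs ?es"
    unfolding twining_def Let_def
  proof (intro conjI cw)
    show "distinct ?vs" using cyclic by (simp add: cyclic_walk_def)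
    show "\<forall>i<length ?vs. endvertices M (?es ! i) = {?vs ! i, ?vs ! (Suc i mod length ?vs)} \<and>
        endvertices M (?es ! (i + length ?vs)) = {?vs ! i, ?vs ! (Suc i mod length ?vs)}"
      using v_mod v_k[of "Suc _"] by (auto simp: ends)
    show "\<exists>d d'. \<forall>i<length ?vs. subtend M d (?vs ! i) (?es ! i) (?es ! (i + length ?vs)) \<and>
        subtend M d' (?vs ! (Suc i mod length ?vs)) (?es ! i) (?es ! (i + length ?vs))"
      using sd sd' v_mod by (intro exI[of _ d] exI[of _ d']) auto
    show "\<exists>\<mu>\<in>carrier (Aut M). \<forall>i<length ?vs. \<mu> ` (?vs ! i) = ?vs ! i \<and>
        \<mu> ` (?es ! i) = ?es ! (i + length ?vs) \<and> \<mu> ` (?es ! (i + length ?vs)) = ?es ! i"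
      using h by (intro bexI[of _ h]) (auto simp: h_v h_e per aut_def)
  qed
  moreover have "range e = set ?es"
    using range_periodic[of "k + k" e] per k(1) by (simp add: add.assoc)
  ultimately show ?thesis unfolding is_twining_def by blast
qed

text \<open>The edges traversed at the steps congruent to \<open>i\<close> modulo \<open>k\<close>.\<close>
definition bead :: "nat \<Rightarrow> 'f set set" where
  "bead i = range (\<lambda>b. edge_of ((h ^^ b) (y i)))"

lemma h_pow_y: "(h ^^ b) (y i) = y (i + k * b)"
proof (induction b)
  case (Suc b)
  then show ?case by (simp add: h_y algebra_simps)
qed simp

lemma bead_eq: "bead i = range (\<lambda>b. e (i + k * b))"
  by (simp add: bead_def h_pow_y e_def)

lemma range_e: "range e = (\<Union>i<k. bead i)"
proof
  have "e n \<in> bead (n mod k)" for n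
    unfolding bead_eq by (rule range_eqI[of _ _ "n div k"]) simp
  moreover have "n mod k < k" for n using k2 by simp
  ultimately show "range e \<subseteq> (\<Union>i<k. bead i)" by blast
qed (auto simp: bead_eq)

text \<open>As \<open>h\<close> is not an involution it rotates every vertex.  One spacing \<open>d\<close> serves all beads and both
  ends of each: it is the same at all \<open>y i\<close>, and \<open>r0 (y i)\<close> lies in the vertex of \<open>y (i + 1)\<close>.\<close>
lemma bead_between_bead:
  assumes neq: "e k \<noteq> e 0" and hh: "h \<circ> h \<noteq> id"
  obtains d where "\<And>i. bead_between M d (v i) (v (Suc i)) (bead i)"
proof -
  have hhy: "h (h (y i)) \<noteq> y i" for i
  proof
    assume "h (h (y i)) = y i"
    then have "h \<circ> h = id"
      using aut_fix[OF aut_funpow[OF h, of 2] y_flags] by (simp add: numeral_2_eq_2)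
    then show False using hh by simp
  qed
  obtain d where d: "spacing h d (y 0)" using spacing_exists[OF h h_fixes_vertex hhy] .
  have sp: "spacing h d (y i)" for i
  proof -
    have "h ((g ^^ i) z) = (g ^^ i) (h z)" for z
      unfolding h_def by (rule funpow_comm) simp
    then have "spacing h d ((g ^^ i) (y 0))" using spacing_aut[OF gi _ d] by blast
    then show ?thesis using y_add[of i 0] by simp
  qed
  have "bead_between M d (v i) (v (Suc i)) (bead i)" for i
  proof -
    have "r0 M (y i) \<in> vertex_of (y (Suc i))"
      using v_r0[of i] by (simp only: v_def vertex_of_cong)
    then have sp': "spacing h d (r0 M (y i))" using spacing_vertex[OF h _ sp] by blast
    have "e (i + k) \<noteq> e i" using neq e_add_iff[of i k 0] by simp
    then have "edge_of (h (y i)) \<noteq> edge_of (y i)" by (simp add: h_y e_def)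
    then have "bead_between M d (vertex_of (y i)) (vertex_of (r0 M (y i))) (bead i)"
      unfolding bead_def
      by (intro orbit_bead y_flags noloop h h_fixes_vertex h_fixes_vertex_r0 hhy sp sp')
    then show ?thesis by (simp only: v_r0) (simp only: v_def)
  qed
  then show ?thesis by (rule that)
qed

text \<open>If the \<open>k\<close> beads are distinct they form a bracelet on the cycle of the first \<open>k\<close> edges.  Two of
  them can only coincide if they join the same two vertices; then \<open>k = 2\<close> and the whole edge-set is a
  single bead.\<close>
lemma bead_or_bracelet:
  assumes "e k \<noteq> e 0" and "h \<circ> h \<noteq> id"
  shows "is_bead M (range e) \<or> is_bracelet M (range e)"
proof (cases "inj_on bead {0..<k}")
  case True
  obtain d where d: "\<And>i. bead_between M d (v i) (v (Suc i)) (bead i)"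
    using bead_between_bead[OF assms] by blast
  have "is_bracelet M (range e)"
    unfolding is_bracelet_def
  proof (intro exI conjI)
    show "cyclic_walk M (map v [0..<k]) (map e [0..<k])" by (rule cyclic)
    show "length (map bead [0..<k]) = length (map v [0..<k])" by simp
    show "distinct (map bead [0..<k])" using True by (simp add: distinct_map)
    show "\<forall>i<length (map v [0..<k]). bead_between M d (map v [0..<k] ! i)
        (map v [0..<k] ! (Suc i mod length (map v [0..<k]))) (map bead [0..<k] ! i)"
      using d v_mod by auto
    show "range e = \<Union> (set (map bead [0..<k]))" by (auto simp: range_e)
  qed
  then show ?thesis by simp
next
  case False
  obtain d where d: "\<And>i. bead_between M d (v i) (v (Suc i)) (bead i)"
    using bead_between_bead[OF assms] by blast
  obtain i j where ij: "i < j" "j < k" "bead i = bead j"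
  proof -
    obtain i j where "i < k" "j < k" "i \<noteq> j" "bead i = bead j"
      using False by (auto simp: inj_on_def)
    then show ?thesis by (cases "i < j") (auto intro: that[of i j] that[of j i])
  qed
  have "e i \<in> bead i" unfolding bead_eq by (rule range_eqI[of _ _ 0]) simp
  then have "endvertices M (e i) = {v j, v (Suc j)}"
    using d[of j] unfolding ij(3) bead_between_def by blast
  then have "{v i, v (Suc i)} = {v j, v (Suc j)}" by (simp only: ends)
  then have v: "v (Suc i) = v j" "v (Suc j) = v i"
    using v_inj[OF ij(1,2)] by (metis doubleton_eq_iff)+
  have j: "j = Suc i" using v(1) v_inj[of "Suc i" j] ij by fastforce
  then have "v 2 = v 0" using v(2) v_add_iff[of i 2 0] by simp
  then have "k = 2" using v_neq_0[of 2] k2 by fastforce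
  then have "range e = bead 0" using ij j by (auto simp: range_e lessThan_Suc numeral_2_eq_2)
  then have "is_bead M (range e)" using d[of 0] unfolding is_bead_def by auto
  then show ?thesis by simp
qed

end


section \<open>Edge-sets of consistent closed flag-walks\<close>

theorem theorem6p1:
  fixes M :: "'f flag_map" and q :: nat
  assumes "is_map M" and "finite (flags M)"
    and "dart_transitive M" and "has_valence M q"
    and "2 \<le> card (vertices M)"
  shows "\<forall>W. closed_flag_walk M W \<and> consistent M W \<longrightarrow>
    is_cycle M (edge_set M W) \<or> is_twining M (edge_set M W) \<or>
    is_bead M (edge_set M W) \<or> is_bracelet M (edge_set M W)"
proof (intro allI impI)
  fix W assume W: "closed_flag_walk M W \<and> consistent M W"
  interpret finite_map M by unfold_locales (fact assms)+
  define n x where "n = length W" and "x = W ! 0"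
  have n: "1 \<le> n" and WF: "set W \<subseteq> flags M"
    using W by (auto simp: closed_flag_walk_def n_def)
  obtain g where g: "aut g" "group.ord (Aut M) g = n"
    and gW: "\<And>i. Suc i < n \<Longrightarrow> g (W ! i) = W ! Suc i"
    using W by (auto simp: consistent_def n_def aut_def)
  have gn: "g ^^ n = id"
  proof -
    interpret group "Aut M" by (rule group_Aut)
    have "g [^]\<^bsub>Aut M\<^esub> n = \<one>\<^bsub>Aut M\<^esub>"
      using pow_ord_eq_1[of g] g by (simp add: aut_def)
    then show ?thesis by (simp add: Aut_pow[OF g(1)]) (simp add: Aut_def perm_group_def)
  qed
  have Wi: "W ! i = (g ^^ i) x" if "i < n" for i
    using that
  proof (induction i)
    case (Suc i)
    then show ?case using gW[of i] by simp
  qed (simp add: x_def)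
  have x: "x \<in> flags M" unfolding x_def by (rule subsetD[OF WF], rule nth_mem)
    (use n in \<open>simp add: n_def Suc_le_eq flip: length_greater_0_conv\<close>)
  \<comment> \<open>For \<open>n = 1\<close> this is where the order of \<open>g\<close> enters: then \<open>g\<close> is the identity.\<close>
  have W1: "W ! (Suc 0 mod n) = g x"
  proof (cases "n = 1")
    case True
    then show ?thesis using gn by (simp add: x_def)
  next
    case False
    then show ?thesis using n Wi[of 1] by simp
  qed
  have "(\<exists>v\<in>vertices M. r0 M x \<in> v \<and> g x \<in> v) \<and> \<not> (\<exists>D\<in>darts M. r0 M x \<in> D \<and> g x \<in> D)"
  proof -
    have "0 < length W" using n by (simp add: n_def flip: length_greater_0_conv)
    from W[THEN conjunct1, unfolded closed_flag_walk_def Let_def, THEN conjunct2, THEN conjunct2,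
        THEN spec, THEN mp, OF this]
    show ?thesis unfolding n_def[symmetric] W1 x_def[symmetric] .
  qed
  then obtain z where z: "r0 M x \<in> vertex_of z" "g x \<in> vertex_of z"
    and no_dart: "\<not> (\<exists>D\<in>darts M. r0 M x \<in> D \<and> g x \<in> D)"
    by (auto simp only: vertices_def)
  have step: "vertex_of (g x) = vertex_of (r0 M x)"
    using z by (simp only: vertex_of_cong[symmetric])
  have "dart_of (r0 M x) \<in> darts M" using x by simp
  then have no_backtrack: "g x \<notin> dart_of (r0 M x)"
    using no_dart gen_orbit_self[of "r0 M x" "flags M" "{r2 M}"] by blast
  \<comment> \<open>The walk returns to its first vertex after at most \<open>n\<close> steps, because \<open>g ^^ n = id\<close>.\<close>
  define k where "k = (LEAST k. 1 \<le> k \<and> vertex_of ((g ^^ k) x) = vertex_of x)"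
  have k: "1 \<le> k \<and> vertex_of ((g ^^ k) x) = vertex_of x"
    unfolding k_def by (rule LeastI[of _ n]) (use n in \<open>simp add: gn\<close>)
  have least: "vertex_of ((g ^^ s) x) \<noteq> vertex_of x" if "1 \<le> s" "s < k" for s
    using not_less_Least[of s "\<lambda>k. 1 \<le> k \<and> vertex_of ((g ^^ k) x) = vertex_of x"] that
    by (simp add: k_def)
  interpret consistent_walk M x g k
    using no_loops assms(3,5) x g(1) step no_backtrack k least by unfold_locales blast+
  have "edge_set M W = edge_of ` set W"
  proof -
    have "E = edge_of z" if E: "E \<in> edges M" "z \<in> E" for E z
    proof -
      obtain w where w: "E = edge_of w" using E(1) by (auto simp only: edges_def)
      then show ?thesis using E(2) by (simp only: edge_of_cong[symmetric])
    qed
    moreover have "edge_of z \<in> edges M \<and> z \<in> edge_of z" if "z \<in> set W" for z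
      using that WF edge_of_in gen_orbit_self[of z "flags M" "{r0 M, r2 M}"] by blast
    ultimately show ?thesis unfolding edge_set_def by blast
  qed
  also have "set W = y ` {0..<n}"
    using Wi by (force simp: set_conv_nth n_def y_def)
  also have "edge_of ` y ` {0..<n} = e ` {0..<n}" by (simp add: image_image e_def)
  also have "\<dots> = range e"
    using range_periodic[of n e] n gn by (simp add: e_def y_def funpow_add)
  finally have E: "edge_set M W = range e" .
  show "is_cycle M (edge_set M W) \<or> is_twining M (edge_set M W) \<or>
    is_bead M (edge_set M W) \<or> is_bracelet M (edge_set M W)"
    unfolding E using cycle_if_edge_fixed twining_if_involution bead_or_bracelet by blast
qed

end
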